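(* Let $b_1, b_2 \in C(\partial D, \mathbb{R})$ and $c_1, c_2 \in \mathbb{R}$. The bicomplex Schwarz boundary value problem for $w = p^+ w^+ + p^- w^- : D \to \mathbb{B}$, \[ \begin{cases} \bar\partial w = 0 \ \text{ in } D,\\ \operatorname{Re}\{w^+\}|_{\partial D} = b_1, \\ \operatorname{Re}\{w^-\}|_{\partial D} = b_2,\\ \operatorname{Im}\{ w^+(0)\} = c_1, \\ \operatorname{Im}\{ w^-(0) \} = c_2, \end{cases} \] is uniquely solved by \[ w(z) = p^+ \left(\frac{1}{2\pi i }\int_{|\zeta| = 1} b_1(\zeta)\, \frac{\overline{\zeta + z}}{\overline{\zeta - z}}\, \frac{d\zeta}{\zeta} + ic_1 \right) + p^- \left(\frac{1}{2\pi i }\int_{|\zeta| = 1} b_2(\zeta)\, \frac{\zeta + z}{\zeta - z}\, \frac{d\zeta}{\zeta} +ic_2 \right). \]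
   Context: $D$ is the open unit disk in $\mathbb{C}$ and $\partial D$ is the unit circle; $C(\partial D,\mathbb{R})$ is the set of continuous real-valued functions on $\partial D$. The bicomplex numbers $\mathbb{B}$ are $\mathbb{C}^2$ with the usual addition and scalar multiplication and with the commutative product $(z_1,z_2)(w_1,w_2) = (z_1w_1 - z_2w_2,\, z_1w_2+z_2w_1)$; one writes $(z_1,z_2) = z_1 + j z_2$, so $j^2=-1$ and $j$ commutes with $i$. Put $p^\pm := \frac12(1 \pm ji)\in\mathbb{B}$. Every $z\in\mathbb{B}$ has a unique representation $z = p^+ z^+ + p^- z^-$ with $z^\pm\in\mathbb{C}$; for a $\mathbb{B}$-valued function $w$, the complex-valued functions $w^\pm$ are the components in this representation. The bicomplex operator $\bar\partial$ is $\bar\partial := p^+\frac{\partial}{\partial z} + p^-\frac{\partial}{\partial \bar z}$, where $\frac{\partial}{\partial z},\frac{\partial}{\partial\bar z}$ are the complex Wirtinger derivatives; thus $\bar\partial w = p^+ \frac{\partial w^+}{\partial z} + p^- \frac{\partial w^-}{\partial \bar z}$. Overlines on numbers or complex-valued functions denote ordinary complex conjugation. *)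

theory Defs
  imports "HOL-Complex_Analysis.Complex_Analysis"
begin

section \<open>Bicomplex numbers\<close>

text \<open>
  The library type \<open>complex \<times> complex\<close> supplies addition, topology and differentiability; it carries
  no multiplication, so the bicomplex product gets its own symbol. The pair \<open>(a, b)\<close> is
  \<open>a + j b\<close>.
\<close>

type_synonym bicomplex = "complex \<times> complex"

definition bc_mult :: "bicomplex \<Rightarrow> bicomplex \<Rightarrow> bicomplex"  (infixl \<open>\<odot>\<close> 70) where
  "z \<odot> w = (fst z * fst w - snd z * snd w, fst z * snd w + snd z * fst w)"

definition bc_of_complex :: "complex \<Rightarrow> bicomplex" where
  "bc_of_complex a = (a, 0)"

definition bc_j :: bicomplex where
  "bc_j = (0, 1)"

definition p_plus :: bicomplex where
  "p_plus = bc_of_complex (1/2) \<odot> (bc_of_complex 1 + bc_j \<odot> bc_of_complex \<i>)"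

definition p_minus :: bicomplex where
  "p_minus = bc_of_complex (1/2) \<odot> (bc_of_complex 1 - bc_j \<odot> bc_of_complex \<i>)"

text \<open>The descriptions below are well defined by \<open>bc_unique_representation\<close>.\<close>

definition bc_plus :: "bicomplex \<Rightarrow> complex" where
  "bc_plus z = (THE a. \<exists>b. z = p_plus \<odot> bc_of_complex a + p_minus \<odot> bc_of_complex b)"

definition bc_minus :: "bicomplex \<Rightarrow> complex" where
  "bc_minus z = (THE b. \<exists>a. z = p_plus \<odot> bc_of_complex a + p_minus \<odot> bc_of_complex b)"

lemma bc_representation_iff:
  "z = p_plus \<odot> bc_of_complex a + p_minus \<odot> bc_of_complex b \<longleftrightarrow>
     a = fst z - \<i> * snd z \<and> b = fst z + \<i> * snd z"
proof -
  have e: "p_plus \<odot> bc_of_complex a + p_minus \<odot> bc_of_complex b = ((a + b) / 2, \<i> * (a - b) / 2)"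
    by (simp add: p_plus_def p_minus_def bc_mult_def bc_of_complex_def bc_j_def field_simps)
  have "x = (a + b) / 2 \<and> y = \<i> * (a - b) / 2 \<longleftrightarrow> a = x - \<i> * y \<and> b = x + \<i> * y" for x y
    by (auto simp: complex_eq_iff field_simps)
  then show ?thesis
    unfolding e by (cases z) simp
qed

lemma bc_unique_representation:
  "\<exists>!(a, b). z = p_plus \<odot> bc_of_complex a + p_minus \<odot> bc_of_complex b"
  unfolding bc_representation_iff by auto

lemma bc_plus_eq: "bc_plus z = fst z - \<i> * snd z"
  unfolding bc_plus_def bc_representation_iff by auto

lemma bc_minus_eq: "bc_minus z = fst z + \<i> * snd z"
  unfolding bc_minus_def bc_representation_iff by auto


section \<open>Wirtinger derivatives and the bicomplex operator\<close>

definition partial_x :: "(complex \<Rightarrow> complex) \<Rightarrow> complex \<Rightarrow> complex" where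
  "partial_x f z = vector_derivative (\<lambda>t. f (z + of_real t)) (at 0)"

definition partial_y :: "(complex \<Rightarrow> complex) \<Rightarrow> complex \<Rightarrow> complex" where
  "partial_y f z = vector_derivative (\<lambda>t. f (z + \<i> * of_real t)) (at 0)"

definition wirtinger_dz :: "(complex \<Rightarrow> complex) \<Rightarrow> complex \<Rightarrow> complex" where
  "wirtinger_dz f z = (partial_x f z - \<i> * partial_y f z) / 2"

definition wirtinger_dzbar :: "(complex \<Rightarrow> complex) \<Rightarrow> complex \<Rightarrow> complex" where
  "wirtinger_dzbar f z = (partial_x f z + \<i> * partial_y f z) / 2"

text \<open>On bicomplex-valued functions the complex Wirtinger derivatives act componentwise.\<close>

definition bc_dbar :: "(complex \<Rightarrow> bicomplex) \<Rightarrow> complex \<Rightarrow> bicomplex" where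
  "bc_dbar w z =
     p_plus \<odot> (wirtinger_dz (\<lambda>u. fst (w u)) z, wirtinger_dz (\<lambda>u. snd (w u)) z)
   + p_minus \<odot> (wirtinger_dzbar (\<lambda>u. fst (w u)) z, wirtinger_dzbar (\<lambda>u. snd (w u)) z)"

lemma bc_dbar_eq:
  assumes "w differentiable (at z)"
  shows "bc_dbar w z = p_plus \<odot> bc_of_complex (wirtinger_dz (\<lambda>u. bc_plus (w u)) z)
                     + p_minus \<odot> bc_of_complex (wirtinger_dzbar (\<lambda>u. bc_minus (w u)) z)"
proof -
  have line: "(\<lambda>t::real. g (w (z + c * of_real t))) differentiable (at 0)"
    if g: "bounded_linear g" for g :: "bicomplex \<Rightarrow> complex" and c
  proof -
    obtain w' where "(w has_derivative w') (at z)"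
      using assms by (auto simp: differentiable_def)
    then have *: "(w has_derivative w') (at (z + c * of_real 0))" by simp
    have "((\<lambda>t::real. z + c * of_real t) has_derivative (\<lambda>t. c * of_real t)) (at 0)"
      by (auto intro!: derivative_eq_intros)
    from has_derivative_compose[OF this *] bounded_linear.has_derivative[OF g]
    show ?thesis unfolding differentiable_def by blast
  qed
  have pm: "vector_derivative (\<lambda>t. fst (w (z + c * of_real t)) + k * snd (w (z + c * of_real t))) (at 0)
      = vector_derivative (\<lambda>t. fst (w (z + c * of_real t))) (at 0)
        + k * vector_derivative (\<lambda>t. snd (w (z + c * of_real t))) (at 0)" for c k
  proof -
    note d = line[OF bounded_linear_fst, of c, unfolded vector_derivative_works]
             line[OF bounded_linear_snd, of c, unfolded vector_derivative_works]
    show ?thesis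
      by (rule vector_derivative_at)
         (intro has_vector_derivative_add d has_vector_derivative_mult_right)
  qed
  note px = pm[of 1, simplified] and py = pm[of \<i>]
  note q = px[of "- \<i>"] px[of \<i>] py[of "- \<i>"] py[of \<i>]
  show ?thesis
    unfolding bc_dbar_def wirtinger_dz_def wirtinger_dzbar_def partial_x_def partial_y_def
      bc_plus_eq bc_minus_eq
    using q
    by (simp add: p_plus_def p_minus_def bc_mult_def bc_of_complex_def bc_j_def)
       (simp add: field_simps)
qed


section \<open>The Schwarz boundary value problem\<close>

text \<open>
  A solution is required to be real differentiable at each point of the disk, not merely to have
  partial derivatives there (which would destroy uniqueness). The boundary conditions are
  unrestricted limits from inside the disk.
\<close>

definition bicomplex_schwarz_bvp ::
  "(complex \<Rightarrow> real) \<Rightarrow> (complex \<Rightarrow> real) \<Rightarrow> real \<Rightarrow> real \<Rightarrow> (complex \<Rightarrow> bicomplex) \<Rightarrow> bool" where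
  "bicomplex_schwarz_bvp b1 b2 c1 c2 w \<longleftrightarrow>
     (\<forall>z\<in>ball 0 1. w differentiable (at z) \<and> bc_dbar w z = 0) \<and>
     (\<forall>\<zeta>\<in>sphere 0 1. ((\<lambda>z. Re (bc_plus (w z))) \<longlongrightarrow> b1 \<zeta>) (at \<zeta> within ball 0 1)) \<and>
     (\<forall>\<zeta>\<in>sphere 0 1. ((\<lambda>z. Re (bc_minus (w z))) \<longlongrightarrow> b2 \<zeta>) (at \<zeta> within ball 0 1)) \<and>
     Im (bc_plus (w 0)) = c1 \<and>
     Im (bc_minus (w 0)) = c2"

end

theory Submission
  imports Defs
begin

text \<open>
  In the idempotent components the operator decouples: a differentiable \<open>w\<close> satisfies
  \<open>bc_dbar w = 0\<close> exactly when \<open>w\<^sup>-\<close> and the conjugate of \<open>w\<^sup>+\<close> are holomorphic. As conjugation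
  leaves real parts alone, the bicomplex problem is a pair of independent Schwarz problems for
  holomorphic functions on the disk (\<open>bicomplex_schwarz_bvp_iff\<close>), and the conjugated kernel in the
  first component is what turns the holomorphic solution back into \<open>w\<^sup>+\<close>.

  Existence: the Schwarz integral is a Cauchy integral minus a constant, hence holomorphic, and its
  real part is the Poisson integral of the boundary function. That the Poisson integral takes the
  right boundary values is proved by Korovkin's device, without any estimate of the kernel. The
  Poisson integral is a positive linear operator that fixes \<open>1\<close> and \<open>Re (a * \<zeta>)\<close>, by
  Cauchy's formula. On the circle, \<open>norm (\<zeta> - \<zeta>0)\<^sup>2\<close> lies in the span of these functions, and
  continuity of \<open>b\<close> gives \<open>\<bar>b \<zeta> - b \<zeta>0\<bar> \<le> \<epsilon> + C * norm (\<zeta> - \<zeta>0)\<^sup>2\<close>. The Poisson integral of the right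
  side is an affine function of \<open>z\<close> with value \<open>\<epsilon>\<close> at \<open>\<zeta>0\<close>, and by positivity it bounds the error
  (\<open>poisson_integral_boundary_limit\<close>).

  Uniqueness: the difference \<open>f\<close> of two holomorphic solutions has real part tending to \<open>0\<close> at the
  boundary. The maximum modulus principle for \<open>exp \<circ> f\<close> and \<open>exp \<circ> (- f)\<close> makes the real part
  vanish, the open mapping theorem makes \<open>f\<close> constant, and the prescribed imaginary part at \<open>0\<close>
  makes it zero (\<open>holomorphic_eq_0_of_boundary\<close>).
\<close>

section \<open>Means over the unit circle\<close>

lemma norm_unit_circle [simp]: "norm (circlepath 0 1 t) = 1"
  by (simp add: circlepath)

lemma unit_circle_nonzero [simp]: "circlepath 0 1 t \<noteq> 0"
  by (simp add: circlepath)

lemma continuous_on_unit_circle: "continuous_on S (circlepath 0 1)"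
  unfolding circlepath by (intro continuous_intros)

lemma continuous_on_circle_compose:
  assumes "continuous_on (sphere 0 1) f"
  shows "continuous_on {0..1::real} (\<lambda>t. f (circlepath 0 1 t))"
  by (rule continuous_on_compose2[OF assms continuous_on_unit_circle]) auto

lemma vector_derivative_unit_circle:
  "vector_derivative (circlepath 0 1) (at t) = 2 * of_real pi * \<i> * circlepath 0 1 t"
  unfolding vector_derivative_circlepath by (simp add: circlepath)

text \<open>
  The measure \<open>d\<zeta> / (2 \<pi> i \<zeta>)\<close> on the circle is normalised arc length. The identity holds also
  for non-integrable \<open>F\<close>, where both sides take the same default value, so that the solution
  formula can be rewritten at every \<open>z\<close>, including points on and outside the circle.
\<close>

lemma contour_integral_eq_circle_mean:
  "1 / (2 * of_real pi * \<i>) * contour_integral (circlepath 0 1) (\<lambda>\<zeta>. F \<zeta> * (1 / \<zeta>)) =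
    integral {0..1} (\<lambda>t. F (circlepath 0 1 t))"
proof -
  have "contour_integral (circlepath 0 1) (\<lambda>\<zeta>. F \<zeta> * (1 / \<zeta>)) =
      integral {0..1} (\<lambda>t. 2 * of_real pi * \<i> * F (circlepath 0 1 t))"
    unfolding contour_integral_integral vector_derivative_unit_circle
    by (intro integral_cong) simp
  then show ?thesis by simp
qed

lemma has_circle_mean:
  assumes "((\<lambda>\<zeta>. F \<zeta> / \<zeta>) has_contour_integral (2 * of_real pi * \<i> * I)) (circlepath 0 1)"
  shows "((\<lambda>t. F (circlepath 0 1 t)) has_integral I) {0..1}"
proof -
  have "((\<lambda>t. 2 * of_real pi * \<i> * F (circlepath 0 1 t)) has_integral (2 * of_real pi * \<i> * I)) {0..1}"
    using assms unfolding has_contour_integral vector_derivative_unit_circle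
    by (rule has_integral_eq[rotated]) simp
  then show ?thesis
    by (subst (asm) has_integral_mult_right_iff) simp_all
qed


section \<open>The Poisson kernel\<close>

definition poisson_kernel :: "complex \<Rightarrow> complex \<Rightarrow> real" where
  "poisson_kernel \<zeta> z = Re ((\<zeta> + z) / (\<zeta> - z))"

lemma poisson_kernel_nonneg:
  assumes "norm \<zeta> = 1" "norm z < 1"
  shows "0 \<le> poisson_kernel \<zeta> z"
proof -
  have "Re ((\<zeta> + z) * cnj (\<zeta> - z)) = (norm \<zeta>)\<^sup>2 - (norm z)\<^sup>2"
    by (simp only: cmod_power2) (simp add: algebra_simps power2_eq_square)
  moreover have "(norm z)\<^sup>2 \<le> 1"
    using assms by (simp add: power_le_one)
  ultimately show ?thesis
    using assms unfolding poisson_kernel_def by (simp add: Re_complex_div_ge_0)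
qed

text \<open>
  On the circle the conjugate of \<open>\<zeta>\<close> is \<open>1 / \<zeta>\<close>, so the kernel extends to a rational function
  of \<open>\<zeta>\<close>: a Cauchy kernel plus a term that is holomorphic in the closed disk and vanishes at
  \<open>\<zeta> = 0\<close>.
\<close>

lemma poisson_kernel_split:
  assumes "norm \<zeta> = 1" "norm z < 1"
  shows "of_real (poisson_kernel \<zeta> z) = \<zeta> / (\<zeta> - z) + \<zeta> * cnj z / (1 - \<zeta> * cnj z)"
proof -
  have "\<zeta> * cnj \<zeta> = 1"
    using assms by (simp add: complex_norm_square[symmetric])
  then have inv: "cnj \<zeta> = 1 / \<zeta>"
    by (metis nonzero_mult_div_cancel_left mult_zero_left zero_neq_one)
  have nz: "\<zeta> \<noteq> 0" "\<zeta> \<noteq> z" using assms by auto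
  have nz': "1 - \<zeta> * cnj z \<noteq> 0"
  proof
    assume "1 - \<zeta> * cnj z = 0"
    then have "norm (\<zeta> * cnj z) = 1" by simp
    then show False using assms by (simp add: norm_mult)
  qed
  have c: "cnj ((\<zeta> + z) / (\<zeta> - z)) = (1 + \<zeta> * cnj z) / (1 - \<zeta> * cnj z)"
    using nz nz' by (simp add: inv divide_simps) (simp add: mult.commute)
  have "complex_of_real (poisson_kernel \<zeta> z) = ((\<zeta> + z) / (\<zeta> - z) + cnj ((\<zeta> + z) / (\<zeta> - z))) / 2"
    unfolding poisson_kernel_def complex_add_cnj by simp
  also have "\<dots> = \<zeta> / (\<zeta> - z) + \<zeta> * cnj z / (1 - \<zeta> * cnj z)"
    unfolding c using nz nz' by (simp add: divide_simps) (simp add: algebra_simps)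
  finally show ?thesis .
qed

lemma continuous_on_schwarz_kernel:
  fixes z :: complex
  assumes "norm z < 1"
  shows "continuous_on (sphere 0 1) (\<lambda>\<zeta>. (\<zeta> + z) / (\<zeta> - z))"
  using assms by (intro continuous_intros) auto

lemma continuous_on_poisson_kernel:
  assumes "norm z < 1"
  shows "continuous_on (sphere 0 1) (\<lambda>\<zeta>. poisson_kernel \<zeta> z)"
  unfolding poisson_kernel_def
  by (intro continuous_intros continuous_on_schwarz_kernel assms)

text \<open>
  Against \<open>h\<close>, the first term of the split kernel gives \<open>h z\<close> by Cauchy's formula at \<open>z\<close>, and the
  second gives \<open>0\<close> by Cauchy's formula at the centre.
\<close>

lemma poisson_formula_holomorphic:
  assumes "continuous_on (cball 0 1) h" "h holomorphic_on ball 0 1" "norm z < 1"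
  shows "((\<lambda>t. h (circlepath 0 1 t) * of_real (poisson_kernel (circlepath 0 1 t) z)) has_integral h z) {0..1}"
proof -
  have nz: "1 - u * cnj z \<noteq> 0" if "norm u \<le> 1" for u
  proof
    assume "1 - u * cnj z = 0"
    then have "norm (u * cnj z) = 1" by simp
    moreover have "norm u * norm z \<le> 1 * norm z"
      using that by (intro mult_right_mono) auto
    ultimately show False using assms(3) by (simp add: norm_mult)
  qed
  have 1: "((\<lambda>t. h (circlepath 0 1 t) * (circlepath 0 1 t / (circlepath 0 1 t - z))) has_integral h z) {0..1}"
  proof (rule has_circle_mean)
    have "((\<lambda>u. h u / (u - z)) has_contour_integral 2 * of_real pi * \<i> * h z) (circlepath 0 1)"
      using assms by (intro Cauchy_integral_circlepath) auto
    then show "((\<lambda>u. h u * (u / (u - z)) / u) has_contour_integral 2 * of_real pi * \<i> * h z) (circlepath 0 1)"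
      by (rule has_contour_integral_eq) auto
  qed
  have 2: "((\<lambda>t. h (circlepath 0 1 t) * (circlepath 0 1 t * cnj z / (1 - circlepath 0 1 t * cnj z)))
      has_integral h 0 * (0 * cnj z / (1 - 0 * cnj z))) {0..1}"
  proof (rule has_circle_mean)
    have "((\<lambda>u. h u * (u * cnj z / (1 - u * cnj z)) / (u - 0)) has_contour_integral
        2 * of_real pi * \<i> * (h 0 * (0 * cnj z / (1 - 0 * cnj z)))) (circlepath 0 1)"
      using assms nz
      by (intro Cauchy_integral_circlepath continuous_intros holomorphic_intros) auto
    then show "((\<lambda>u. h u * (u * cnj z / (1 - u * cnj z)) / u) has_contour_integral
        2 * of_real pi * \<i> * (h 0 * (0 * cnj z / (1 - 0 * cnj z)))) (circlepath 0 1)"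
      by simp
  qed
  show ?thesis
    using has_integral_add[OF 1 2] poisson_kernel_split[OF norm_unit_circle assms(3)]
    by (simp add: distrib_left)
qed

definition poisson_integral :: "(complex \<Rightarrow> real) \<Rightarrow> complex \<Rightarrow> real" where
  "poisson_integral b z = integral {0..1} (\<lambda>t. b (circlepath 0 1 t) * poisson_kernel (circlepath 0 1 t) z)"

lemma poisson_integrable:
  assumes "continuous_on (sphere 0 1) b" "norm z < 1"
  shows "(\<lambda>t. b (circlepath 0 1 t) * poisson_kernel (circlepath 0 1 t) z) integrable_on {0..1}"
  by (intro integrable_continuous_real continuous_on_mult
      continuous_on_circle_compose[OF assms(1)]
      continuous_on_circle_compose[OF continuous_on_poisson_kernel[OF assms(2)]])

text \<open>
  The test functions for Korovkin's argument.
\<close>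

lemma poisson_integral_Re_affine:
  assumes "norm z < 1"
  shows "poisson_integral (\<lambda>\<zeta>. c + Re (a * \<zeta>)) z = c + Re (a * z)"
proof -
  have "((\<lambda>t. (of_real c + a * circlepath 0 1 t) * of_real (poisson_kernel (circlepath 0 1 t) z))
      has_integral (of_real c + a * z)) {0..1}"
    using assms by (intro poisson_formula_holomorphic continuous_intros holomorphic_intros)
  from has_integral_linear[OF this bounded_linear_Re] show ?thesis
    unfolding poisson_integral_def by (intro integral_unique) (simp add: o_def)
qed

lemma poisson_integral_diff:
  assumes "continuous_on (sphere 0 1) b" "continuous_on (sphere 0 1) c" "norm z < 1"
  shows "poisson_integral (\<lambda>\<zeta>. b \<zeta> - c \<zeta>) z = poisson_integral b z - poisson_integral c z"
  using integral_diff[OF poisson_integrable[OF assms(1,3)] poisson_integrable[OF assms(2,3)]]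
  unfolding poisson_integral_def by (simp add: left_diff_distrib)

text \<open>
  This is where positivity of the kernel enters.
\<close>

lemma poisson_integral_abs_le:
  assumes "continuous_on (sphere 0 1) b" "continuous_on (sphere 0 1) c" "norm z < 1"
    and "\<And>\<zeta>. norm \<zeta> = 1 \<Longrightarrow> \<bar>b \<zeta>\<bar> \<le> c \<zeta>"
  shows "\<bar>poisson_integral b z\<bar> \<le> poisson_integral c z"
  unfolding poisson_integral_def real_norm_def[symmetric]
proof (rule integral_norm_bound_integral[OF poisson_integrable poisson_integrable])
  fix t
  show "norm (b (circlepath 0 1 t) * poisson_kernel (circlepath 0 1 t) z)
      \<le> c (circlepath 0 1 t) * poisson_kernel (circlepath 0 1 t) z"
    using assms(4)[OF norm_unit_circle] poisson_kernel_nonneg[OF norm_unit_circle assms(3)]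
    by (simp add: abs_mult mult_right_mono)
qed (use assms in auto)

lemma poisson_integral_boundary_limit:
  assumes b: "continuous_on (sphere 0 1) b" and \<zeta>0: "norm \<zeta>0 = 1"
  shows "(poisson_integral b \<longlongrightarrow> b \<zeta>0) (at \<zeta>0 within ball 0 1)"
proof (rule tendstoI)
  fix e :: real assume e: "e > 0"
  obtain d where d: "d > 0" "\<And>\<zeta>. norm \<zeta> = 1 \<Longrightarrow> dist \<zeta> \<zeta>0 < d \<Longrightarrow> \<bar>b \<zeta> - b \<zeta>0\<bar> < e / 2"
    using b \<zeta>0 e unfolding continuous_on_iff
    by (metis dist_real_def half_gt_zero mem_sphere_0)
  have "compact (b ` sphere 0 1)"
    by (intro compact_continuous_image b compact_sphere)
  then obtain M where M: "M > 0" "\<And>\<zeta>. norm \<zeta> = 1 \<Longrightarrow> \<bar>b \<zeta>\<bar> \<le> M"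
    by (metis bounded_pos compact_imp_bounded imageI mem_sphere_0 real_norm_def)
  \<comment> \<open>Chosen so that \<open>C * d\<^sup>2\<close> covers the largest possible oscillation \<open>2 * M\<close> away from \<open>\<zeta>0\<close>.\<close>
  define C where "C = 2 * M / d\<^sup>2"
  have C: "C > 0" using M d by (simp add: C_def)
  \<comment> \<open>The majorant \<open>e / 2 + C * norm (\<zeta> - \<zeta>0)\<^sup>2\<close>, written on the circle as a function that the
    Poisson integral fixes.\<close>
  define q where "q \<zeta> = (e / 2 + 2 * C) + Re (- of_real (2 * C) * cnj \<zeta>0 * \<zeta>)" for \<zeta>
  have q_eq: "q \<zeta> = e / 2 + C * (norm (\<zeta> - \<zeta>0))\<^sup>2" if "norm \<zeta> = 1" for \<zeta>
  proof -
    have "(Re \<zeta>)\<^sup>2 + (Im \<zeta>)\<^sup>2 = 1" "(Re \<zeta>0)\<^sup>2 + (Im \<zeta>0)\<^sup>2 = 1"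
      using that \<zeta>0 by (simp_all flip: cmod_power2)
    then have "(norm (\<zeta> - \<zeta>0))\<^sup>2 = 2 - 2 * Re (cnj \<zeta>0 * \<zeta>)"
      unfolding cmod_power2 by (simp add: power2_diff algebra_simps)
    moreover have "q \<zeta> = e / 2 + C * (2 - 2 * Re (cnj \<zeta>0 * \<zeta>))"
      unfolding q_def by (simp add: algebra_simps)
    ultimately show ?thesis by simp
  qed
  have le_q: "\<bar>b \<zeta> - b \<zeta>0\<bar> \<le> q \<zeta>" if \<zeta>: "norm \<zeta> = 1" for \<zeta>
  proof (cases "dist \<zeta> \<zeta>0 < d")
    case True
    then show ?thesis
      using d(2)[OF \<zeta> True] C by (simp add: q_eq[OF \<zeta>] add_increasing2)
  next
    case False
    then have "d\<^sup>2 \<le> (norm (\<zeta> - \<zeta>0))\<^sup>2"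
      using d(1) by (intro power_mono) (auto simp: dist_norm)
    then have "C * d\<^sup>2 \<le> C * (norm (\<zeta> - \<zeta>0))\<^sup>2"
      using C by (intro mult_left_mono) auto
    moreover have "C * d\<^sup>2 = 2 * M" using d by (simp add: C_def)
    moreover have "\<bar>b \<zeta> - b \<zeta>0\<bar> \<le> 2 * M" using M(2)[OF \<zeta>] M(2)[OF \<zeta>0] by linarith
    ultimately show ?thesis using e by (simp add: q_eq[OF \<zeta>])
  qed
  have q_cont: "continuous_on UNIV q"
    unfolding q_def by (intro continuous_intros)
  have bound: "\<bar>poisson_integral b z - b \<zeta>0\<bar> \<le> q z" if z: "norm z < 1" for z
  proof -
    have "\<bar>poisson_integral (\<lambda>\<zeta>. b \<zeta> - b \<zeta>0) z\<bar> \<le> poisson_integral q z"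
      using le_q by (intro poisson_integral_abs_le b continuous_on_subset[OF q_cont] z continuous_intros) auto
    moreover have "poisson_integral q z = q z"
      unfolding q_def by (rule poisson_integral_Re_affine[OF z])
    moreover have "poisson_integral (\<lambda>\<zeta>. b \<zeta>0) z = b \<zeta>0"
      using poisson_integral_Re_affine[OF z, of "b \<zeta>0" 0] by simp
    ultimately show ?thesis
      using poisson_integral_diff[OF b _ z, of "\<lambda>_. b \<zeta>0"] by simp
  qed
  have "isCont q \<zeta>0"
    using q_cont by (simp add: continuous_on_eq_continuous_at)
  then have "(q \<longlongrightarrow> q \<zeta>0) (at \<zeta>0 within ball 0 1)"
    unfolding isCont_def by (rule tendsto_within_subset) simp
  moreover have "q \<zeta>0 < e" using q_eq[OF \<zeta>0] e by simp
  ultimately have "\<forall>\<^sub>F z in at \<zeta>0 within ball 0 1. q z < e"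
    by (rule order_tendstoD)
  moreover have "\<forall>\<^sub>F z in at \<zeta>0 within ball 0 1. z \<in> ball 0 1"
    by (simp add: eventually_at_filter)
  ultimately show "\<forall>\<^sub>F z in at \<zeta>0 within ball 0 1. dist (poisson_integral b z) (b \<zeta>0) < e"
    by eventually_elim (use bound in \<open>force simp: dist_real_def\<close>)
qed


section \<open>The Schwarz integral\<close>

definition schwarz_integral :: "(complex \<Rightarrow> real) \<Rightarrow> complex \<Rightarrow> complex" where
  "schwarz_integral b z = 1 / (2 * of_real pi * \<i>) *
     contour_integral (circlepath 0 1) (\<lambda>\<zeta>. of_real (b \<zeta>) * ((\<zeta> + z) / (\<zeta> - z)) * (1 / \<zeta>))"

text \<open>
  The mean is taken against a real measure, so conjugating the Schwarz integral of a real function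
  only conjugates the kernel.
\<close>

lemma cnj_schwarz_integral:
  "1 / (2 * of_real pi * \<i>) * contour_integral (circlepath 0 1)
     (\<lambda>\<zeta>. of_real (b \<zeta>) * (cnj (\<zeta> + z) / cnj (\<zeta> - z)) * (1 / \<zeta>)) = cnj (schwarz_integral b z)"
  unfolding schwarz_integral_def contour_integral_eq_circle_mean integral_cnj
  by simp

lemma schwarz_integrable:
  assumes "continuous_on (sphere 0 1) b" "norm z < 1"
  shows "(\<lambda>t. of_real (b (circlepath 0 1 t)) * ((circlepath 0 1 t + z) / (circlepath 0 1 t - z)))
     integrable_on {0..1}"
  by (intro integrable_continuous_real continuous_on_mult continuous_on_of_real
      continuous_on_circle_compose[OF assms(1)]
      continuous_on_circle_compose[OF continuous_on_schwarz_kernel[OF assms(2)]])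

lemma Re_schwarz_integral:
  assumes "continuous_on (sphere 0 1) b" "norm z < 1"
  shows "Re (schwarz_integral b z) = poisson_integral b z"
  unfolding schwarz_integral_def contour_integral_eq_circle_mean poisson_integral_def poisson_kernel_def
  using integral_linear[OF schwarz_integrable[OF assms] bounded_linear_Re]
  by (simp add: o_def del: times_divide_eq_right times_divide_eq_left)

lemma schwarz_integral_boundary_limit:
  assumes "continuous_on (sphere 0 1) b" "norm \<zeta>0 = 1"
  shows "((\<lambda>z. Re (schwarz_integral b z)) \<longlongrightarrow> b \<zeta>0) (at \<zeta>0 within ball 0 1)"
  by (rule Lim_transform_within[OF poisson_integral_boundary_limit[OF assms], of 1])
     (simp_all add: Re_schwarz_integral assms)

text \<open>
  At the centre the kernel is \<open>1\<close>, so the integral is a mean of real numbers.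
\<close>

lemma schwarz_integral_0: "Im (schwarz_integral b 0) = 0"
proof -
  have "cnj (schwarz_integral b 0) = schwarz_integral b 0"
    unfolding cnj_schwarz_integral[symmetric]
    by (simp add: schwarz_integral_def contour_integral_eq_circle_mean)
  then show ?thesis by (simp add: complex_eq_iff)
qed

text \<open>
  By partial fractions \<open>(\<zeta> + z) / ((\<zeta> - z) * \<zeta>) = 2 / (\<zeta> - z) - 1 / \<zeta>\<close>, which expresses the
  Schwarz integral through the Cauchy integral \<open>g\<close> of the boundary function.
\<close>

lemma schwarz_integral_holomorphic:
  assumes b: "continuous_on (sphere 0 1) b"
  shows "schwarz_integral b holomorphic_on ball 0 1"
proof -
  define f where "f \<zeta> = complex_of_real (b \<zeta>)" for \<zeta>
  \<comment> \<open>The exponent \<open>1\<close> matches the shape of the library lemma on differentiating Cauchy integrals.\<close>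
  define g where "g w = contour_integral (circlepath 0 1) (\<lambda>u. f u / (u - w) ^ 1)" for w
  have f: "continuous_on (path_image (circlepath 0 1)) f"
    unfolding f_def using b by (auto intro: continuous_intros)
  have g: "((\<lambda>u. f u / (u - w) ^ 1) has_contour_integral g w) (circlepath 0 1)" if "w \<in> ball 0 1" for w
    unfolding g_def
    by (rule has_contour_integral_integral, rule contour_integrable_continuous_circlepath)
       (use that f in \<open>auto intro!: continuous_intros\<close>)
  have "g holomorphic_on ball 0 1"
    unfolding holomorphic_on_open[OF open_ball]
    using Cauchy_next_derivative_circlepath(2)[OF f g one_neq_zero] by blast
  then have "(\<lambda>z. 1 / (2 * of_real pi * \<i>) * (2 * g z - g 0)) holomorphic_on ball 0 1"
    by (intro holomorphic_intros)
  moreover have "1 / (2 * of_real pi * \<i>) * (2 * g z - g 0) = schwarz_integral b z"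
    if z: "z \<in> ball 0 1" for z
  proof -
    have "((\<lambda>u. 2 * (f u / (u - z) ^ 1) - f u / (u - 0) ^ 1) has_contour_integral (2 * g z - g 0))
        (circlepath 0 1)"
      by (intro has_contour_integral_diff has_contour_integral_lmul g z) simp
    then have "((\<lambda>\<zeta>. of_real (b \<zeta>) * ((\<zeta> + z) / (\<zeta> - z)) * (1 / \<zeta>)) has_contour_integral (2 * g z - g 0))
        (circlepath 0 1)"
    proof (rule has_contour_integral_eq)
      fix u assume "u \<in> path_image (circlepath 0 1)"
      then have "u \<noteq> 0" "u \<noteq> z" using z by auto
      then show "2 * (f u / (u - z) ^ 1) - f u / (u - 0) ^ 1 =
          of_real (b u) * ((u + z) / (u - z)) * (1 / u)"
        by (simp add: f_def divide_simps) (simp add: algebra_simps)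
    qed
    then show ?thesis
      unfolding schwarz_integral_def by (simp add: contour_integral_unique)
  qed
  ultimately show ?thesis
    by (rule holomorphic_transform)
qed


section \<open>Uniqueness for the holomorphic problem\<close>

text \<open>
  Only the real part of \<open>f\<close> is controlled at the boundary, so \<open>f\<close> need not extend continuously to
  the closed disk. Its real part does, after setting it to \<open>0\<close> on the circle, and therefore has a
  maximum there. If the maximum lies inside, the maximum modulus principle for \<open>exp \<circ> f\<close> makes the
  real part constant, and the boundary limit identifies the constant.
\<close>

lemma holomorphic_Re_le_0_of_boundary:
  assumes hol: "f holomorphic_on ball 0 1"
    and bd: "\<And>\<zeta>. norm \<zeta> = 1 \<Longrightarrow> ((\<lambda>z. Re (f z)) \<longlongrightarrow> 0) (at \<zeta> within ball 0 1)"
    and z: "norm z < 1"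
  shows "Re (f z) \<le> 0"
proof -
  define u where "u x = (if norm x < 1 then Re (f x) else 0)" for x :: complex
  have u_in: "continuous_on (ball 0 1) u"
  proof -
    have "continuous_on (ball 0 1) (\<lambda>x. Re (f x))"
      using hol by (intro continuous_intros holomorphic_on_imp_continuous_on)
    then show ?thesis
      by (rule continuous_on_eq) (simp add: u_def)
  qed
  have "(u \<longlongrightarrow> u x) (at x within cball 0 1)" if x: "x \<in> cball 0 1" for x
  proof (cases "norm x < 1")
    case True
    then have "isCont u x"
      using u_in by (simp add: continuous_on_eq_continuous_at)
    then show ?thesis
      unfolding isCont_def by (rule tendsto_within_subset) simp
  next
    case False
    then have x1: "norm x = 1" using x by simp
    have "(u \<longlongrightarrow> 0) (at x within ball 0 1)"
      by (rule Lim_transform_within[OF bd[OF x1], of 1]) (simp_all add: u_def)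
    moreover have "(u \<longlongrightarrow> 0) (at x within sphere 0 1)"
      by (rule Lim_transform_within[OF tendsto_const, of 1]) (simp_all add: u_def)
    ultimately have "(u \<longlongrightarrow> 0) (at x within (ball 0 1 \<union> sphere 0 1))"
      by (rule Lim_Un)
    moreover have "ball 0 1 \<union> sphere 0 1 = cball (0::complex) 1" by auto
    ultimately show ?thesis using x1 by (simp add: u_def)
  qed
  then have "continuous_on (cball 0 1) u"
    by (simp add: continuous_on_def)
  then obtain m where m: "m \<in> cball 0 1" "\<And>x. x \<in> cball 0 1 \<Longrightarrow> u x \<le> u m"
    using continuous_attains_sup[of "cball 0 1" u] by (metis cball_eq_empty compact_cball not_one_less_zero)
  have "u m \<le> 0"
  proof (cases "norm m < 1")
    case True
    have "(\<lambda>x. exp (f x)) constant_on ball 0 1"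
    proof (rule maximum_modulus_principle)
      show "(\<lambda>x. exp (f x)) holomorphic_on ball 0 1"
        using hol by (intro holomorphic_intros)
      show "norm (exp (f x)) \<le> norm (exp (f m))" if "x \<in> ball 0 1" for x
        using m(2)[of x] that True by (simp add: u_def)
    qed (use True in auto)
    then obtain c where c: "\<And>x. norm x < 1 \<Longrightarrow> exp (f x) = c"
      unfolding constant_on_def by auto
    have Re_const: "Re (f x) = Re (f m)" if "norm x < 1" for x
      using c[OF that] c[OF True] by (metis norm_exp_eq_Re exp_inj_iff)
    have "((\<lambda>x. Re (f m)) \<longlongrightarrow> 0) (at (1::complex) within ball 0 1)"
      by (rule Lim_transform_within[OF bd[of 1], of 1]) (simp_all add: Re_const)
    moreover have "at (1::complex) within ball 0 1 \<noteq> bot"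
      by (simp add: trivial_limit_within islimpt_ball)
    ultimately have "Re (f m) = 0"
      by (simp add: tendsto_const_iff)
    then show ?thesis using True by (simp add: u_def)
  next
    case False
    then show ?thesis by (simp add: u_def)
  qed
  then show ?thesis
    using m(2)[of z] z by (simp add: u_def)
qed

text \<open>
  A function with values on the imaginary axis has no open image, so it is constant.
\<close>

lemma holomorphic_eq_0_of_boundary:
  assumes hol: "f holomorphic_on ball 0 1"
    and bd: "\<And>\<zeta>. norm \<zeta> = 1 \<Longrightarrow> ((\<lambda>z. Re (f z)) \<longlongrightarrow> 0) (at \<zeta> within ball 0 1)"
    and im: "Im (f 0) = 0"
    and z: "norm z < 1"
  shows "f z = 0"
proof -
  have Re0: "Re (f x) = 0" if "norm x < 1" for x
  proof -
    have "Re (- f x) \<le> 0"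
      using tendsto_minus[OF bd]
      by (intro holomorphic_Re_le_0_of_boundary[OF holomorphic_on_minus[OF hol] _ that]) simp
    then show ?thesis
      using holomorphic_Re_le_0_of_boundary[OF hol bd that] by simp
  qed
  have "f constant_on ball 0 1"
  proof (rule ccontr)
    assume "\<not> f constant_on ball 0 1"
    then have "open (f ` ball 0 1)"
      using open_mapping_thm[OF hol, of "ball 0 1"] by simp
    then obtain e where e: "e > 0" "ball (f 0) e \<subseteq> f ` ball 0 1"
      by (metis centre_in_ball imageI open_contains_ball zero_less_one)
    then have "f 0 + of_real (e / 2) \<in> f ` ball 0 1"
      by (intro subsetD[OF e(2)]) (simp add: dist_norm)
    then show False using Re0 Re0[of 0] e(1) by (auto simp: complex_eq_iff)
  qed
  then have "f z = f 0"
    using z by (auto simp: constant_on_def)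
  then show ?thesis
    using Re0[of 0] im by (simp add: complex_eq_iff)
qed


section \<open>Wirtinger derivatives and holomorphy\<close>

lemma partial_derivatives_of_has_derivative:
  assumes "(f has_derivative f') (at z)"
  shows "partial_x f z = f' 1" "partial_y f z = f' \<i>"
proof -
  have line: "vector_derivative (\<lambda>t::real. f (z + c * of_real t)) (at 0) = f' c" for c
  proof (rule vector_derivative_at)
    have "((\<lambda>t::real. z + c * of_real t) has_derivative (\<lambda>t. c * of_real t)) (at 0)"
      by (auto intro!: derivative_eq_intros)
    moreover have "(f has_derivative f') (at (z + c * of_real 0))"
      using assms by simp
    ultimately have "((\<lambda>t::real. f (z + c * of_real t)) has_derivative (\<lambda>t. f' (c * of_real t))) (at 0)"
      by (rule has_derivative_compose)
    moreover have "f' (c * of_real t) = t *\<^sub>R f' c" for t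
      using linear_scale[OF has_derivative_linear[OF assms], of t c]
      by (simp add: scaleR_conv_of_real mult.commute)
    ultimately show "((\<lambda>t::real. f (z + c * of_real t)) has_vector_derivative f' c) (at 0)"
      by (simp add: has_vector_derivative_def)
  qed
  show "partial_x f z = f' 1" using line[of 1] by (simp add: partial_x_def)
  show "partial_y f z = f' \<i>" using line[of \<i>] by (simp add: partial_y_def)
qed

text \<open>
  The Cauchy--Riemann equations: the real-linear derivative \<open>f'\<close> is multiplication by a complex
  number exactly when \<open>f' \<i> = \<i> * f' 1\<close>.
\<close>

lemma wirtinger_dzbar_eq_0_iff:
  assumes "f differentiable (at z)"
  shows "wirtinger_dzbar f z = 0 \<longleftrightarrow> f field_differentiable (at z)"
proof
  obtain f' where f': "(f has_derivative f') (at z)"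
    using assms by (auto simp: differentiable_def)
  note partials = partial_derivatives_of_has_derivative[OF f']
  assume "wirtinger_dzbar f z = 0"
  then have "f' 1 + \<i> * f' \<i> = 0"
    by (simp add: wirtinger_dzbar_def partials)
  then have "\<i> * (f' 1 + \<i> * f' \<i>) = 0" by simp
  then have i: "f' \<i> = \<i> * f' 1" by (simp add: algebra_simps)
  have "f' h = f' 1 * h" for h
  proof -
    note lin = has_derivative_linear[OF f']
    have "f' h = f' (Re h *\<^sub>R 1 + Im h *\<^sub>R \<i>)"
      by (rule arg_cong[of _ _ f']) (simp add: complex_eq_iff)
    also have "\<dots> = Re h *\<^sub>R f' 1 + Im h *\<^sub>R f' \<i>"
      by (simp only: linear_add[OF lin] linear_scale[OF lin])
    also have "\<dots> = f' 1 * h"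
      by (simp add: i scaleR_conv_of_real complex_eq_iff)
    finally show ?thesis .
  qed
  then have "f' = (*) (f' 1)" by (rule ext)
  then show "f field_differentiable (at z)"
    using f' unfolding field_differentiable_def has_field_derivative_def by metis
next
  assume "f field_differentiable (at z)"
  then obtain c where "(f has_derivative (*) c) (at z)"
    unfolding field_differentiable_def has_field_derivative_def by auto
  from partial_derivatives_of_has_derivative[OF this] show "wirtinger_dzbar f z = 0"
    by (simp add: wirtinger_dzbar_def algebra_simps)
qed

lemma wirtinger_dzbar_cnj:
  assumes "f differentiable (at z)"
  shows "wirtinger_dzbar (\<lambda>u. cnj (f u)) z = cnj (wirtinger_dz f z)"
proof -
  obtain f' where f': "(f has_derivative f') (at z)"
    using assms by (auto simp: differentiable_def)
  show ?thesis
    using partial_derivatives_of_has_derivative[OF f']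
      partial_derivatives_of_has_derivative[OF has_derivative_cnj[OF f']]
    by (simp add: wirtinger_dz_def wirtinger_dzbar_def)
qed

text \<open>
  Recovering \<open>w\<close> from its components is a real-linear operation, and so is passing to them. The
  first component is conjugated because it is in this form that it becomes holomorphic.
\<close>

lemma bc_components_differentiable_iff:
  "w differentiable (at z) \<longleftrightarrow>
     (\<lambda>u. cnj (bc_plus (w u))) differentiable (at z) \<and> (\<lambda>u. bc_minus (w u)) differentiable (at z)"
  (is "_ \<longleftrightarrow> ?R")
proof
  assume "w differentiable (at z)"
  then obtain w' where w': "(w has_derivative w') (at z)"
    by (auto simp: differentiable_def)
  show ?R
    unfolding bc_plus_eq bc_minus_eq differentiable_def
    by (auto intro!: exI derivative_eq_intros w')
next
  assume ?R
  then obtain p m where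
    p: "((\<lambda>u. cnj (bc_plus (w u))) has_derivative p) (at z)" and
    m: "((\<lambda>u. bc_minus (w u)) has_derivative m) (at z)"
    by (auto simp: differentiable_def)
  have "((\<lambda>u. bc_plus (w u)) has_derivative (\<lambda>h. cnj (p h))) (at z)"
    using has_derivative_cnj[OF p] by simp
  then have "((\<lambda>u. ((bc_plus (w u) + bc_minus (w u)) / 2,
       \<i> * (bc_plus (w u) - bc_minus (w u)) / 2)) has_derivative
     (\<lambda>h. ((cnj (p h) + m h) / 2, \<i> * (cnj (p h) - m h) / 2))) (at z)"
    by (auto intro!: derivative_eq_intros m)
  moreover have "((bc_plus (w u) + bc_minus (w u)) / 2, \<i> * (bc_plus (w u) - bc_minus (w u)) / 2) = w u" for u
    by (simp add: bc_plus_eq bc_minus_eq prod_eq_iff)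
  ultimately show "w differentiable (at z)"
    by (auto simp: differentiable_def)
qed

lemma bc_dbar_eq_0_iff:
  "w differentiable (at z) \<and> bc_dbar w z = 0 \<longleftrightarrow>
     (\<lambda>u. cnj (bc_plus (w u))) field_differentiable (at z) \<and>
     (\<lambda>u. bc_minus (w u)) field_differentiable (at z)"
proof (cases "w differentiable (at z)")
  case True
  then have d: "(\<lambda>u. cnj (bc_plus (w u))) differentiable (at z)"
      "(\<lambda>u. bc_minus (w u)) differentiable (at z)"
    by (simp_all add: bc_components_differentiable_iff)
  then have dp: "(\<lambda>u. bc_plus (w u)) differentiable (at z)"
    by (simp add: differentiable_cnj_iff)
  have "bc_dbar w z = 0 \<longleftrightarrow>
      wirtinger_dz (\<lambda>u. bc_plus (w u)) z = 0 \<and> wirtinger_dzbar (\<lambda>u. bc_minus (w u)) z = 0"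
    using bc_representation_iff[of 0] unfolding bc_dbar_eq[OF True] by (metis fst_zero snd_zero diff_zero add_0 mult_zero_right)
  then show ?thesis
    using True wirtinger_dzbar_cnj[OF dp]
    by (simp add: wirtinger_dzbar_eq_0_iff[OF d(1), symmetric] wirtinger_dzbar_eq_0_iff[OF d(2), symmetric])
next
  case False
  then show ?thesis
    unfolding bc_components_differentiable_iff
    by (auto dest: field_differentiable_imp_differentiable)
qed


section \<open>The bicomplex problem\<close>

lemma bicomplex_schwarz_bvp_iff:
  "bicomplex_schwarz_bvp b1 b2 c1 c2 w \<longleftrightarrow>
     (\<lambda>z. cnj (bc_plus (w z))) holomorphic_on ball 0 1 \<and>
     (\<lambda>z. bc_minus (w z)) holomorphic_on ball 0 1 \<and>
     (\<forall>\<zeta>\<in>sphere 0 1. ((\<lambda>z. Re (bc_plus (w z))) \<longlongrightarrow> b1 \<zeta>) (at \<zeta> within ball 0 1)) \<and>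
     (\<forall>\<zeta>\<in>sphere 0 1. ((\<lambda>z. Re (bc_minus (w z))) \<longlongrightarrow> b2 \<zeta>) (at \<zeta> within ball 0 1)) \<and>
     Im (bc_plus (w 0)) = c1 \<and> Im (bc_minus (w 0)) = c2"
proof -
  have "f holomorphic_on ball 0 1 \<longleftrightarrow> (\<forall>z\<in>ball 0 1. f field_differentiable (at z))" for f
    by (simp add: holomorphic_on_def at_within_open[OF _ open_ball])
  then show ?thesis
    unfolding bicomplex_schwarz_bvp_def bc_dbar_eq_0_iff by blast
qed

lemma bc_components_of_representation:
  "bc_plus (p_plus \<odot> bc_of_complex a + p_minus \<odot> bc_of_complex b) = a"
  "bc_minus (p_plus \<odot> bc_of_complex a + p_minus \<odot> bc_of_complex b) = b"
  unfolding bc_plus_eq bc_minus_eq by (metis bc_representation_iff)+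

lemma bicomplex_schwarz_bvp_unique:
  assumes "bicomplex_schwarz_bvp b1 b2 c1 c2 v" "bicomplex_schwarz_bvp b1 b2 c1 c2 w" and z: "norm z < 1"
  shows "v z = w z"
proof -
  note vw = assms(1,2)[unfolded bicomplex_schwarz_bvp_iff]
  have plus: "((\<lambda>z. Re (bc_plus (v z)) - Re (bc_plus (w z))) \<longlongrightarrow> b1 \<zeta> - b1 \<zeta>) (at \<zeta> within ball 0 1)"
    and minus: "((\<lambda>z. Re (bc_minus (v z)) - Re (bc_minus (w z))) \<longlongrightarrow> b2 \<zeta> - b2 \<zeta>) (at \<zeta> within ball 0 1)"
    if "norm \<zeta> = 1" for \<zeta>
    using vw that by (intro tendsto_diff; simp)+
  have "cnj (bc_plus (v z)) - cnj (bc_plus (w z)) = 0"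
    using vw plus by (intro holomorphic_eq_0_of_boundary[OF holomorphic_on_diff _ _ z]) auto
  moreover have "bc_minus (v z) - bc_minus (w z) = 0"
    using vw minus by (intro holomorphic_eq_0_of_boundary[OF holomorphic_on_diff _ _ z]) auto
  ultimately show ?thesis
    using bc_representation_iff[of "v z"] bc_representation_iff[of "w z"]
    by (metis bc_plus_eq bc_minus_eq complex_cnj_cancel_iff eq_iff_diff_eq_0)
qed

theorem theorem3p1:
  fixes b1 b2 :: "complex \<Rightarrow> real" and c1 c2 :: real
  assumes "continuous_on (sphere 0 1) b1" and "continuous_on (sphere 0 1) b2"
  shows "let W = (\<lambda>z.
             p_plus \<odot> bc_of_complex
               (1 / (2 * of_real pi * \<i>) *
                  contour_integral (circlepath 0 1)
                    (\<lambda>\<zeta>. of_real (b1 \<zeta>) * (cnj (\<zeta> + z) / cnj (\<zeta> - z)) * (1 / \<zeta>))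
                + \<i> * of_real c1)
           + p_minus \<odot> bc_of_complex
               (1 / (2 * of_real pi * \<i>) *
                  contour_integral (circlepath 0 1)
                    (\<lambda>\<zeta>. of_real (b2 \<zeta>) * ((\<zeta> + z) / (\<zeta> - z)) * (1 / \<zeta>))
                + \<i> * of_real c2))
         in bicomplex_schwarz_bvp b1 b2 c1 c2 W \<and>
            (\<forall>w. bicomplex_schwarz_bvp b1 b2 c1 c2 w \<longrightarrow> (\<forall>z\<in>ball 0 1. w z = W z))"
proof -
  define W where "W z = p_plus \<odot> bc_of_complex (cnj (schwarz_integral b1 z) + \<i> * of_real c1)
      + p_minus \<odot> bc_of_complex (schwarz_integral b2 z + \<i> * of_real c2)" for z
  have "bicomplex_schwarz_bvp b1 b2 c1 c2 W"
    unfolding bicomplex_schwarz_bvp_iff W_def bc_components_of_representation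
    using assms schwarz_integral_0
    by (auto intro!: holomorphic_intros schwarz_integral_holomorphic
        simp: schwarz_integral_boundary_limit)
  then have "bicomplex_schwarz_bvp b1 b2 c1 c2 W \<and>
      (\<forall>w. bicomplex_schwarz_bvp b1 b2 c1 c2 w \<longrightarrow> (\<forall>z\<in>ball 0 1. w z = W z))"
    using bicomplex_schwarz_bvp_unique by auto
  then show ?thesis
    unfolding Let_def cnj_schwarz_integral schwarz_integral_def[symmetric] W_def[abs_def] .
qed

end
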